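(* Let $\varepsilon>0$ and let $\mathcal{F}$ be the family of all functions $f$ meromorphic in the open unit disk $\mathbb{D}$ such that $f^\#(z)\ge\varepsilon$ for all $z\in\mathbb{D}$. Then $\mathcal{F}$ is normal in $\mathbb{D}$.
   Context: $\mathbb{D}=\{z\in\mathbb{C}:|z|<1\}$. The spherical derivative of a meromorphic function $f$ is $f^\#:=\frac{|f'|}{1+|f|^2}$, extended continuously to the poles of $f$ (equivalently, $f^\#(z_0)=(1/f)^\#(z_0)$ at a pole $z_0$). A family $\mathcal{F}$ of meromorphic functions in a domain $D\subseteq\mathbb{C}$ is normal in $D$ (in the sense of Montel) if every sequence in $\mathcal{F}$ has a subsequence that converges locally uniformly in $D$ with respect to the spherical metric, the limit being either a meromorphic function in $D$ or identically $\infty$. *)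

theory Defs
  imports "HOL-Complex_Analysis.Complex_Analysis"
begin

datatype riemann_sphere = Fin complex | Infty

fun chordal_dist :: "riemann_sphere \<Rightarrow> riemann_sphere \<Rightarrow> real" where
  "chordal_dist (Fin a) (Fin b) = norm (a - b) / (sqrt (1 + norm a ^ 2) * sqrt (1 + norm b ^ 2))"
| "chordal_dist (Fin a) Infty = 1 / sqrt (1 + norm a ^ 2)"
| "chordal_dist Infty (Fin b) = 1 / sqrt (1 + norm b ^ 2)"
| "chordal_dist Infty Infty = 0"

(* The chordal distance is measured on a sphere of diameter 1, where a chord of length c subtends
   an arc of length arcsin c. This is the geodesic distance of the metric |dz| / (1 + |z|^2),
   matching the normalisation of the spherical derivative. *)
definition spherical_dist :: "riemann_sphere \<Rightarrow> riemann_sphere \<Rightarrow> real" where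
  "spherical_dist p q = arcsin (chordal_dist p q)"

(* A meromorphic function on an open set is represented by a function that is nicely meromorphic
   there: removable singularities are filled in, and at poles the value is the dummy 0.
   The following is the sphere-valued function it stands for. *)
definition sphere_val :: "(complex \<Rightarrow> complex) \<Rightarrow> complex \<Rightarrow> riemann_sphere" where
  "sphere_val f z = (if is_pole f z then Infty else Fin (f z))"

definition spherical_deriv :: "(complex \<Rightarrow> complex) \<Rightarrow> complex \<Rightarrow> real" where
  "spherical_deriv f z =
     (if is_pole f z then Lim (at z) (\<lambda>w. norm (deriv f w) / (1 + norm (f w) ^ 2))
      else norm (deriv f z) / (1 + norm (f z) ^ 2))"

definition spherically_loc_unif_limit ::
    "complex set \<Rightarrow> (nat \<Rightarrow> complex \<Rightarrow> riemann_sphere) \<Rightarrow> (complex \<Rightarrow> riemann_sphere) \<Rightarrow> bool" where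
  "spherically_loc_unif_limit D F G \<longleftrightarrow>
     (\<forall>z0\<in>D. \<exists>U. open U \<and> z0 \<in> U \<and> U \<subseteq> D \<and>
        (\<forall>e>0. \<forall>\<^sub>F n in sequentially. \<forall>z\<in>U. spherical_dist (F n z) (G z) < e))"

definition normal_family :: "complex set \<Rightarrow> (complex \<Rightarrow> complex) set \<Rightarrow> bool" where
  "normal_family D \<F> \<longleftrightarrow>
     (\<forall>f :: nat \<Rightarrow> complex \<Rightarrow> complex. (\<forall>n. f n \<in> \<F>) \<longrightarrow>
        (\<exists>r :: nat \<Rightarrow> nat. strict_mono r \<and>
           ((\<exists>g. g nicely_meromorphic_on D \<and>
                 spherically_loc_unif_limit D (\<lambda>n. sphere_val (f (r n))) (sphere_val g)) \<or>
            spherically_loc_unif_limit D (\<lambda>n. sphere_val (f (r n))) (\<lambda>_. Infty))))"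

(* The limit in the definition of spherical_deriv exists at every pole, and equals the spherical
   derivative of 1/f there. *)
lemma
  assumes mero: "f meromorphic_on {z}" and pole: "is_pole f z"
  defines "g \<equiv> remove_sings (\<lambda>w. inverse (f w))"
  shows tendsto_spherical_deriv_pole:
          "((\<lambda>w. norm (deriv f w) / (1 + norm (f w) ^ 2)) \<longlongrightarrow> spherical_deriv f z) (at z)"
    and spherical_deriv_pole: "spherical_deriv f z = spherical_deriv g z"
proof -
  let ?h = "\<lambda>w. inverse (f w)"
  let ?s = "\<lambda>f w. norm (deriv f w) / (1 + norm (f w) ^ 2) :: real"
  have h0: "?h \<midarrow>z\<rightarrow> 0"
    using pole unfolding is_pole_def by (rule tendsto_inverse_0[THEN filterlim_compose])
  have gz: "g z = 0" unfolding g_def using h0 by (rule remove_sings_eqI)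
  have iso: "isolated_singularity_at f z" using mero by (simp add: meromorphic_at_iff)
  have "?h meromorphic_on {z}" using mero by (intro meromorphic_intros)
  then have isoh: "isolated_singularity_at ?h z" by (simp add: meromorphic_at_iff)
  have gan: "g analytic_on {z}"
    unfolding g_def using isoh h0 by (rule remove_sings_analytic_at)
  have np: "\<not> is_pole g z"
    using gan analytic_at_imp_no_pole by blast
  have ev1: "eventually (\<lambda>w. f analytic_on {w}) (at z)"
    using iso by (simp add: isolated_singularity_at_altdef)
  have ev2: "eventually (\<lambda>w. f w \<noteq> 0) (at z)"
    using pole by (rule non_zero_neighbour_pole)
  have "eventually (\<lambda>w. ?s g w = ?s f w) (at z)"
    using ev1 ev2
  proof eventually_elim
    case (elim w)
    have han: "?h analytic_on {w}"
      using elim by (intro analytic_intros) auto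
    have "deriv g w = deriv ?h w" unfolding g_def using han by simp
    also have "\<dots> = - deriv f w / (f w)\<^sup>2"
    proof -
      have "(f has_field_derivative deriv f w) (at w)"
        using elim(1) by (simp add: analytic_on_imp_differentiable_at DERIV_deriv_iff_field_differentiable)
      from DERIV_inverse_fun[OF this elim(2)] show ?thesis
        by (intro DERIV_imp_deriv) (simp add: field_simps power2_eq_square)
    qed
    finally have dg: "deriv g w = - deriv f w / (f w)\<^sup>2" .
    have gw: "g w = inverse (f w)" unfolding g_def using han by simp
    have "norm (f w) \<noteq> 0" using elim by simp
    then show ?case
      unfolding dg gw by (simp add: norm_divide norm_inverse norm_power field_simps)
  qed
  moreover have "(?s g \<longlongrightarrow> ?s g z) (at z)"
  proof -
    have "isCont g z" "isCont (deriv g) z"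
      using gan by (auto intro!: analytic_at_imp_isCont analytic_deriv)
    then have "isCont (?s g) z"
      by (intro continuous_intros) (simp_all add: add_nonneg_eq_0_iff)
    then show ?thesis by (simp add: isCont_def)
  qed
  ultimately have lim: "(?s f \<longlongrightarrow> ?s g z) (at z)"
    by (rule Lim_transform_eventually[rotated])
  have "Lim (at z) (?s f) = ?s g z"
    by (rule tendsto_Lim[OF _ lim]) simp
  then have eq: "spherical_deriv f z = ?s g z"
    using pole by (simp add: spherical_deriv_def)
  show "(?s f \<longlongrightarrow> spherical_deriv f z) (at z)" using lim by (simp add: eq)
  show "spherical_deriv f z = spherical_deriv g z"
    unfolding eq using np by (simp add: spherical_deriv_def)
qed

end

theory Submission
  imports Defs
begin

text \<open>
  If \<open>f\<close> is meromorphic with \<open>f\<^sup># > 0\<close>, then \<open>f\<close> is locally injective, and locally \<open>f = u / v\<close> with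
  holomorphic \<open>u = f / sqrt f'\<close> and \<open>v = 1 / sqrt f'\<close> whose Wronskian \<open>u' v - u v'\<close> is 1. In these
  terms \<open>f\<^sup># = 1 / (|u|\<^sup>2 + |v|\<^sup>2)\<close>, so a lower bound for the spherical derivative is an
  \<^emph>\<open>upper\<close> bound for the pair of holomorphic functions \<open>(u, v)\<close>, and Montel's theorem
  applies to \<open>u\<close> and \<open>v\<close>. The Wronskian condition survives in the limit and prevents \<open>u\<close> and \<open>v\<close> from
  having a common zero there, which makes the quotients converge in the spherical metric.

  Global square roots are avoided by working with the products
  \<open>A = v\<^sup>2 = 1 / f'\<close>, \<open>B = u v = f / f'\<close>, \<open>C = u\<^sup>2 = f\<^sup>2 / f'\<close>. These are single-valued,
  extend holomorphically over the poles of \<open>f\<close>, and satisfy \<open>|A| + |C| = 1 / f\<^sup>#\<close>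
  (\<open>null_curve_of_meromorphic\<close>). They determine \<open>f = B / A\<close>, and the structure of \<open>(u, v)\<close> is
  encoded by two polynomial relations: \<open>B\<^sup>2 = A C\<close>, and \<open>B'\<^sup>2 - A' C' = 1\<close>, which is the square of the
  Wronskian condition. Both pass to locally uniform limits (\<open>null_curve_at_limit\<close>), and together
  they exclude common zeros of \<open>A\<close> and \<open>C\<close> (\<open>null_curve_at_no_common_zero\<close>). Finally, the squared
  chordal distance between two points is the modulus of a bilinear form in their
  vectors \<open>(A, B, C)\<close>, divided by the two values of \<open>|A| + |C|\<close> (\<open>chordal_dist_null\<close>). Hence uniform convergence of the vectors gives uniform
  convergence on the sphere wherever the limit of \<open>|A| + |C|\<close> is bounded away from 0
  (\<open>null_curves_spherical_limit\<close>), with no distinction between points near 0 and near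
  \<open>\<infinity>\<close>.

  The argument is local and works on every open set.
\<close>

definition sphere_point :: "complex \<Rightarrow> complex \<Rightarrow> riemann_sphere" where
  "sphere_point a b = (if a = 0 then Infty else Fin (b / a))"

text \<open>
  The triple plays the role of \<open>(v\<^sup>2, u v, u\<^sup>2)\<close>, a curve on the null cone of the quadratic form
  \<open>b\<^sup>2 - a c\<close>; evaluated on the derivative of this curve, the form is \<open>(u' v - u v')\<^sup>2\<close>.
\<close>

definition null_curve_at ::
    "(complex \<Rightarrow> complex) \<Rightarrow> (complex \<Rightarrow> complex) \<Rightarrow> (complex \<Rightarrow> complex) \<Rightarrow> complex \<Rightarrow> bool" where
  "null_curve_at A B C z \<longleftrightarrow>
     A analytic_on {z} \<and> B analytic_on {z} \<and> C analytic_on {z} \<and>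
     B z ^ 2 = A z * C z \<and> deriv B z ^ 2 - deriv A z * deriv C z = 1"

section \<open>Null vectors and the chordal distance\<close>

lemma norm_null_le:
  fixes a b c :: complex
  assumes "b ^ 2 = a * c"
  shows "norm b \<le> norm a + norm c"
proof (rule power2_le_imp_le)
  have "norm b ^ 2 = norm a * norm c"
    using assms by (metis norm_mult norm_power)
  also have "\<dots> \<le> (norm a + norm c) ^ 2"
    by (simp add: power2_eq_square algebra_simps)
  finally show "norm b ^ 2 \<le> (norm a + norm c) ^ 2" .
qed simp

lemma norm_null_ratio:
  fixes a b c :: complex
  assumes "b ^ 2 = a * c" "a \<noteq> 0"
  shows "1 + norm (b / a) ^ 2 = (norm a + norm c) / norm a"
proof -
  have "norm b ^ 2 = norm a * norm c"
    using assms(1) by (metis norm_mult norm_power)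
  then show ?thesis
    using assms(2) by (simp add: norm_divide power_divide field_simps power2_eq_square)
qed

lemma chordal_dist_commute: "chordal_dist p q = chordal_dist q p"
  by (cases p; cases q) (simp_all add: norm_minus_commute mult.commute)

lemma chordal_dist_nonneg: "chordal_dist p q \<ge> 0"
  by (cases p; cases q) simp_all

text \<open>
  Writing null vectors as \<open>(a, b, c) = (v\<^sup>2, u v, u\<^sup>2)\<close>, this is the homogeneous formula
  \<open>|u v' - u' v| / (|(u, v)| |(u', v')|)\<close> for the chordal distance: the polarised quadratic form
  \<open>c a' + a c' - 2 b b'\<close> equals \<open>(u v' - u' v)\<^sup>2\<close>, and \<open>|a| + |c| = |(u, v)|\<^sup>2\<close>.
\<close>

lemma chordal_dist_null:
  fixes a b c a' b' c' :: complex
  assumes "b ^ 2 = a * c" "b' ^ 2 = a' * c'" "a \<noteq> 0 \<or> c \<noteq> 0" "a' \<noteq> 0 \<or> c' \<noteq> 0"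
  shows "chordal_dist (sphere_point a b) (sphere_point a' b') ^ 2 =
           norm (c * a' + a * c' - 2 * b * b') / ((norm a + norm c) * (norm a' + norm c'))"
proof -
  have at_infty: "chordal_dist (sphere_point a b) Infty ^ 2 =
           norm (c * a' + a * c' - 2 * b * b') / ((norm a + norm c) * (norm a' + norm c'))"
    if "b ^ 2 = a * c" "b' ^ 2 = a' * c'" "a' = 0" "c' \<noteq> 0" for a b c a' b' c' :: complex
    using that norm_null_ratio[OF that(1)]
    by (auto simp: sphere_point_def power_divide norm_mult)
  consider "a' = 0" | "a = 0" | "a \<noteq> 0" "a' \<noteq> 0" by blast
  then show ?thesis
  proof cases
    case 1
    then show ?thesis using at_infty[OF assms(1,2)] assms(4) by (simp add: sphere_point_def)
  next
    case 2
    then show ?thesis using at_infty[OF assms(2,1)] assms(3)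
      by (simp add: sphere_point_def chordal_dist_commute[of Infty] algebra_simps)
  next
    case 3
    let ?N = "norm a + norm c" and ?N' = "norm a' + norm c'"
    have N: "?N > 0" "?N' > 0"
      using 3 by (simp_all add: add_pos_nonneg)
    \<comment> \<open>The numerator of \<open>b / a - b' / a'\<close> is the polarised form up to the factor \<open>a a'\<close>.\<close>
    have "(b * a' - b' * a) ^ 2 = a * a' * (c * a' + a * c' - 2 * b * b')"
      using assms(1,2) by algebra
    then have "norm (b * a' - b' * a) ^ 2 = norm a * norm a' * norm (c * a' + a * c' - 2 * b * b')"
      by (metis norm_mult norm_power)
    moreover have "norm (b / a - b' / a') ^ 2 = norm (b * a' - b' * a) ^ 2 / (norm a * norm a') ^ 2"
      using 3 by (simp add: diff_frac_eq norm_divide norm_mult power_divide)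
    ultimately have num: "norm (b / a - b' / a') ^ 2 =
        norm (c * a' + a * c' - 2 * b * b') / (norm a * norm a')"
      using 3 by (simp add: power2_eq_square)
    have "chordal_dist (sphere_point a b) (sphere_point a' b') ^ 2 =
        norm (b / a - b' / a') ^ 2 / ((1 + norm (b / a) ^ 2) * (1 + norm (b' / a') ^ 2))"
      using 3 by (simp add: sphere_point_def power_divide power_mult_distrib add_nonneg_nonneg del: norm_divide)
    also have "\<dots> = norm (c * a' + a * c' - 2 * b * b') / (?N * ?N')"
      unfolding num norm_null_ratio[OF assms(1) 3(1)] norm_null_ratio[OF assms(2) 3(2)]
      using 3 N by (simp add: divide_simps)
    finally show ?thesis .
  qed
qed

text \<open>
  The polarised form vanishes on the pair \<open>(x, x)\<close> for a null vector \<open>x\<close>, so on \<open>(x, x')\<close> it is of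
  first order in \<open>x - x'\<close>. The size of \<open>x\<close> cancels; only that of \<open>x'\<close>, for which the limit curve will
  be substituted, remains in the denominator.
\<close>

lemma chordal_dist_null_le:
  fixes a b c a' b' c' :: complex
  assumes "b ^ 2 = a * c" "b' ^ 2 = a' * c'" "a \<noteq> 0 \<or> c \<noteq> 0" "a' \<noteq> 0 \<or> c' \<noteq> 0"
  shows "chordal_dist (sphere_point a b) (sphere_point a' b') ^ 2 \<le>
           (norm (a - a') + 2 * norm (b - b') + norm (c - c')) / (norm a' + norm c')"
proof -
  let ?N = "norm a + norm c" and ?N' = "norm a' + norm c'"
  have N: "?N > 0" "?N' > 0"
    using assms(3,4) by (auto simp: add_pos_nonneg add_nonneg_pos)
  have "c * a' + a * c' - 2 * b * b' = a * (c' - c) - 2 * b * (b' - b) + c * (a' - a)"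
    using assms(1) by (simp add: algebra_simps power2_eq_square)
  also have "norm \<dots> \<le> norm (a * (c' - c)) + norm (2 * b * (b' - b)) + norm (c * (a' - a))"
    by (intro order_trans[OF norm_triangle_ineq] add_mono norm_triangle_ineq4 order_refl)
  also have "\<dots> = norm a * norm (c - c') + 2 * (norm b * norm (b - b')) + norm c * norm (a - a')"
    by (simp add: norm_mult norm_minus_commute)
  also have "\<dots> \<le> ?N * norm (c - c') + 2 * (?N * norm (b - b')) + ?N * norm (a - a')"
    using norm_null_le[OF assms(1)] by (intro add_mono mult_left_mono mult_right_mono) auto
  also have "\<dots> = ?N * (norm (a - a') + 2 * norm (b - b') + norm (c - c'))"
    by (simp add: algebra_simps)
  finally have "norm (c * a' + a * c' - 2 * b * b') \<le> \<dots>" .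
  then have "norm (c * a' + a * c' - 2 * b * b') / (?N * ?N') \<le>
      ?N * (norm (a - a') + 2 * norm (b - b') + norm (c - c')) / (?N * ?N')"
    using N by (intro divide_right_mono) auto
  then show ?thesis
    unfolding chordal_dist_null[OF assms] using N(1) by simp
qed

lemma spherical_dist_less:
  assumes "e > 0"
  obtains d where "d > 0" "\<And>p q. chordal_dist p q ^ 2 < d \<Longrightarrow> spherical_dist p q < e"
proof -
  have "isCont arcsin (0::real)"
    by (rule isCont_arcsin) auto
  then obtain d where d: "d > 0" "\<And>x. \<bar>x\<bar> < d \<Longrightarrow> \<bar>arcsin x\<bar> < e"
    using assms unfolding continuous_at_eps_delta by (force simp: dist_real_def)
  show ?thesis
  proof
    show "d ^ 2 > 0" using d by simp
    show "spherical_dist p q < e" if "chordal_dist p q ^ 2 < d ^ 2" for p q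
      using d(2)[of "chordal_dist p q"] power2_less_imp_less[OF that] d(1) chordal_dist_nonneg[of p q]
      by (simp add: spherical_dist_def)
  qed
qed

section \<open>Null curves\<close>

text \<open>
  This transformation corresponds to passing from \<open>f\<close> to \<open>1 / f\<close>: since \<open>(1 / f)' = - f' / f\<^sup>2\<close>, the
  triple \<open>(1 / f', f / f', f\<^sup>2 / f')\<close> is reversed and negated.
\<close>

lemma null_curve_at_uminus_swap:
  assumes "null_curve_at A B C z"
  shows "null_curve_at (\<lambda>w. - C w) (\<lambda>w. - B w) (\<lambda>w. - A w) z"
  using assms
  by (auto simp: null_curve_at_def analytic_on_imp_differentiable_at mult.commute intro!: analytic_intros)

lemma null_curve_at_cong:
  assumes "null_curve_at A B C z"
    and "eventually (\<lambda>w. A' w = A w) (nhds z)" "eventually (\<lambda>w. B' w = B w) (nhds z)"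
      "eventually (\<lambda>w. C' w = C w) (nhds z)"
  shows "null_curve_at A' B' C' z"
  using assms analytic_at_cong[OF assms(2) refl] analytic_at_cong[OF assms(3) refl]
    analytic_at_cong[OF assms(4) refl] assms(2-4)[THEN eventually_nhds_x_imp_x]
    deriv_cong_ev[OF assms(2) refl] deriv_cong_ev[OF assms(3) refl] deriv_cong_ev[OF assms(4) refl]
  by (simp add: null_curve_at_def)

lemma null_curve_at_analytic:
  assumes u: "u analytic_on {z}" and nz: "deriv u z \<noteq> 0"
  shows "null_curve_at (\<lambda>w. 1 / deriv u w) (\<lambda>w. u w / deriv u w) (\<lambda>w. u w ^ 2 / deriv u w) z"
proof -
  let ?p = "deriv u z" and ?q = "deriv (deriv u) z"
  have du: "deriv u analytic_on {z}"
    using u by (rule analytic_deriv)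
  have D: "(u has_field_derivative ?p) (at z)" "(deriv u has_field_derivative ?q) (at z)"
    using u du by (simp_all add: analytic_on_imp_differentiable_at DERIV_deriv_iff_field_differentiable)
  have 1: "deriv (\<lambda>w. 1 / deriv u w) z = - ?q / ?p ^ 2"
    using nz by (intro DERIV_imp_deriv) (auto intro!: derivative_eq_intros D simp: power2_eq_square)
  have 2: "deriv (\<lambda>w. u w / deriv u w) z = 1 - u z * ?q / ?p ^ 2"
    using nz by (intro DERIV_imp_deriv)
      (auto intro!: derivative_eq_intros D simp: power2_eq_square field_simps)
  have 3: "deriv (\<lambda>w. u w ^ 2 / deriv u w) z = 2 * u z - u z ^ 2 * ?q / ?p ^ 2"
    using nz by (intro DERIV_imp_deriv)
      (auto intro!: derivative_eq_intros D simp: power2_eq_square field_simps)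
  show ?thesis
    unfolding null_curve_at_def 1 2 3 using nz
    by (auto intro!: analytic_intros u du simp: power2_eq_square field_simps)
qed

text \<open>
  At a common zero all three functions vanish, and dividing \<open>B\<^sup>2 = A C\<close> by \<open>(w - z)\<^sup>2\<close> gives
  \<open>B'\<^sup>2 = A' C'\<close> at \<open>z\<close>, against \<open>B'\<^sup>2 - A' C' = 1\<close>.
\<close>

lemma null_curve_at_no_common_zero:
  assumes "null_curve_at A B C z" and null: "eventually (\<lambda>w. B w ^ 2 = A w * C w) (nhds z)"
  shows "A z \<noteq> 0 \<or> C z \<noteq> 0"
proof (rule ccontr)
  assume "\<not> ?thesis"
  then have zero: "A z = 0" "C z = 0" "B z = 0"
    using assms(1) by (auto simp: null_curve_at_def)
  have quot: "((\<lambda>w. F w / (w - z)) \<longlongrightarrow> deriv F z) (at z)"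
    if "F analytic_on {z}" "F z = 0" for F
  proof -
    have "(F has_field_derivative deriv F z) (at z)"
      using that(1) by (simp add: analytic_on_imp_differentiable_at DERIV_deriv_iff_field_differentiable)
    then show ?thesis
      using that(2) by (simp add: has_field_derivative_iff)
  qed
  have lim: "((\<lambda>w. (B w / (w - z)) ^ 2 - A w / (w - z) * (C w / (w - z))) \<longlongrightarrow>
        deriv B z ^ 2 - deriv A z * deriv C z) (at z)"
    using assms(1) zero by (intro tendsto_intros quot) (auto simp: null_curve_at_def)
  have null_at: "eventually (\<lambda>w. B w ^ 2 = A w * C w) (at z)"
    using null by (simp add: eventually_nhds_conv_at)
  have "eventually (\<lambda>w. (B w / (w - z)) ^ 2 - A w / (w - z) * (C w / (w - z)) = 0) (at z)"
    using null_at
    by eventually_elim (simp add: power_divide power2_eq_square)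
  then have "((\<lambda>w. (B w / (w - z)) ^ 2 - A w / (w - z) * (C w / (w - z))) \<longlongrightarrow> 0) (at z)"
    by (rule tendsto_eventually)
  with lim have "deriv B z ^ 2 - deriv A z * deriv C z = 0"
    using tendsto_unique[OF _ lim] by simp
  then show False
    using assms(1) by (simp add: null_curve_at_def)
qed

text \<open>
  Differentiating \<open>B\<^sup>2 = A C\<close> at a zero of \<open>A\<close> yields \<open>A' C = 0\<close>, hence \<open>A' = 0\<close> and \<open>B'\<^sup>2 = 1\<close>. So \<open>B\<close>
  has an isolated zero there, and \<open>B / A = C / B\<close> with \<open>C \<noteq> 0\<close>. In particular \<open>A\<close> cannot vanish
  identically, which is why the constant \<open>\<infinity>\<close> never occurs as a limit.
\<close>

lemma null_curve_is_pole:
  assumes "null_curve_at A B C z" and null: "eventually (\<lambda>w. B w ^ 2 = A w * C w) (nhds z)"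
    and A0: "A z = 0"
  shows "is_pole (\<lambda>w. B w / A w) z"
proof -
  have an: "A analytic_on {z}" "B analytic_on {z}" "C analytic_on {z}"
    using assms(1) by (auto simp: null_curve_at_def)
  have null_at: "eventually (\<lambda>w. B w ^ 2 = A w * C w) (at z)"
    using null by (simp add: eventually_nhds_conv_at)
  have C0: "C z \<noteq> 0"
    using null_curve_at_no_common_zero[OF assms(1,2)] A0 by simp
  have B0: "B z = 0"
    using assms(1) A0 by (simp add: null_curve_at_def)
  have D: "(A has_field_derivative deriv A z) (at z)" "(B has_field_derivative deriv B z) (at z)"
      "(C has_field_derivative deriv C z) (at z)"
    using an by (simp_all add: analytic_on_imp_differentiable_at DERIV_deriv_iff_field_differentiable)
  have "deriv (\<lambda>w. B w ^ 2) z = deriv (\<lambda>w. A w * C w) z"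
    by (rule deriv_cong_ev[OF null refl])
  moreover have "deriv (\<lambda>w. B w ^ 2) z = 0"
    using B0 by (intro DERIV_imp_deriv) (auto intro!: derivative_eq_intros D)
  moreover have "deriv (\<lambda>w. A w * C w) z = deriv A z * C z"
    using A0 by (intro DERIV_imp_deriv) (auto intro!: derivative_eq_intros D)
  ultimately have "deriv A z = 0"
    using C0 by simp
  then have "deriv B z \<noteq> 0"
    using assms(1) by (auto simp: null_curve_at_def)
  moreover have "((\<lambda>w. B w / (w - z)) \<longlongrightarrow> deriv B z) (at z)"
    using D(2) B0 by (simp add: has_field_derivative_iff)
  ultimately have "eventually (\<lambda>w. B w / (w - z) \<noteq> 0) (at z)"
    by (rule tendsto_imp_eventually_ne[rotated])
  then have Bnz: "eventually (\<lambda>w. B w \<noteq> 0) (at z)"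
    by eventually_elim auto
  have "(B \<longlongrightarrow> 0) (at z)"
    using analytic_at_imp_isCont[OF an(2)] B0 by (simp add: isCont_def)
  with Bnz have "filterlim B (at 0) (at z)"
    by (simp add: filterlim_at)
  then have "is_pole (\<lambda>w. C w / B w) z"
    using analytic_at_imp_isCont[OF an(3)] C0 by (intro is_pole_divide)
  moreover have "eventually (\<lambda>w. C w / B w = B w / A w) (at z)"
    using Bnz null_at
    by eventually_elim (auto simp: field_simps power2_eq_square)
  ultimately show ?thesis
    by (rule is_pole_transform) simp
qed

lemma null_curve_sphere_val:
  assumes S: "open S" and null: "\<And>z. z \<in> S \<Longrightarrow> null_curve_at A B C z"
  defines "g \<equiv> remove_sings (\<lambda>w. B w / A w)"
  shows "g nicely_meromorphic_on S"
    and "z \<in> S \<Longrightarrow> sphere_val g z = sphere_point (A z) (B z)"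
proof -
  have an: "A analytic_on {z}" "B analytic_on {z}" if "z \<in> S" for z
    using null[OF that] by (auto simp: null_curve_at_def)
  then have "A analytic_on S" "B analytic_on S"
    using analytic_on_analytic_at by blast+
  then have mero: "(\<lambda>w. B w / A w) meromorphic_on S"
    by (intro meromorphic_intros analytic_on_imp_meromorphic_on)
  then show "g nicely_meromorphic_on S"
    unfolding g_def by (rule remove_sings_nicely_meromorphic)
  show "sphere_val g z = sphere_point (A z) (B z)" if z: "z \<in> S"
  proof -
    have pole_iff: "is_pole g z \<longleftrightarrow> is_pole (\<lambda>w. B w / A w) z"
      unfolding g_def using mero z
      by (meson is_pole_remove_sings_iff meromorphic_on_isolated_singularity meromorphic_on_subset
          empty_subsetI insert_subset)
    show ?thesis
    proof (cases "A z = 0")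
      case True
      have "eventually (\<lambda>w. B w ^ 2 = A w * C w) (nhds z)"
        using eventually_nhds_in_open[OF S z] by eventually_elim (use null in \<open>auto simp: null_curve_at_def\<close>)
      then have "is_pole g z"
        using null_curve_is_pole[OF null[OF z]] True pole_iff by blast
      then show ?thesis using True by (simp add: sphere_val_def sphere_point_def)
    next
      case False
      then have "(\<lambda>w. B w / A w) analytic_on {z}"
        using an[OF z] by (intro analytic_intros) auto
      then show ?thesis
        using False pole_iff analytic_at_imp_no_pole
        by (auto simp: sphere_val_def sphere_point_def g_def)
    qed
  qed
qed

section \<open>The null curve of a locally univalent meromorphic function\<close>

lemma eventually_remove_sings_eq_analytic:
  assumes "H analytic_on {z}" "eventually (\<lambda>w. G w = H w) (at z)"
  shows "eventually (\<lambda>w. remove_sings G w = H w) (nhds z)"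
proof -
  have "isolated_singularity_at H z"
    using assms(1) by (rule isolated_singularity_at_analytic)
  then have "isolated_singularity_at G z"
    using isolated_singularity_at_cong[OF assms(2) refl] by simp
  then have "eventually (\<lambda>w. remove_sings G w = G w) (at z)"
    by (rule eventually_remove_sings_eq_at)
  with assms(2) have "eventually (\<lambda>w. remove_sings G w = H w) (at z)"
    by eventually_elim simp
  moreover have eq: "remove_sings G z = H z"
    using remove_sings_cong[OF assms(2) refl] assms(1) by simp
  ultimately show ?thesis
    unfolding eventually_at_filter by (auto elim!: eventually_mono)
qed

text \<open>Near a pole the null curve of \<open>f\<close> is computed from \<open>1 / f\<close>.\<close>

lemma inverse_near_pole:
  assumes mero: "f meromorphic_on {z}" and pole: "is_pole f z"
  defines "h \<equiv> remove_sings (\<lambda>w. inverse (f w))"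
  shows "h analytic_on {z}" "h z = 0"
    and "eventually (\<lambda>w. f w \<noteq> 0 \<and> h w = inverse (f w) \<and> deriv h w = - deriv f w / f w ^ 2) (at z)"
proof -
  let ?h = "\<lambda>w. inverse (f w)"
  have h0: "?h \<midarrow>z\<rightarrow> 0"
    using pole unfolding is_pole_def by (rule tendsto_inverse_0[THEN filterlim_compose])
  then show "h z = 0" unfolding h_def by (rule remove_sings_eqI)
  have "?h meromorphic_on {z}" using mero by (intro meromorphic_intros)
  then have "isolated_singularity_at ?h z" by (simp add: meromorphic_at_iff)
  then show "h analytic_on {z}" unfolding h_def using h0 by (rule remove_sings_analytic_at)
  have "eventually (\<lambda>w. f analytic_on {w}) (at z)"
    using mero by (simp add: meromorphic_at_iff isolated_singularity_at_altdef)
  then show "eventually (\<lambda>w. f w \<noteq> 0 \<and> h w = inverse (f w) \<and> deriv h w = - deriv f w / f w ^ 2) (at z)"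
    using non_zero_neighbour_pole[OF pole]
  proof eventually_elim
    case (elim w)
    have "?h analytic_on {w}"
      using elim by (intro analytic_intros) auto
    moreover have "deriv ?h w = - deriv f w / f w ^ 2"
      using elim by (simp add: analytic_on_imp_differentiable_at deriv_inverse)
    ultimately show ?case using elim(2) by (simp add: h_def)
  qed
qed

text \<open>
  The reason for the exact value \<open>1 / f\<^sup>#\<close> is \<open>|1 / f'| + |f\<^sup>2 / f'| = (1 + |f|\<^sup>2) / |f'|\<close>. At a pole,
  \<open>f\<^sup>#\<close> is the spherical derivative of \<open>h = 1 / f\<close>, and its positivity says \<open>h' \<noteq> 0\<close>: the
  pole is simple, and the triple extends over it as \<open>-(h\<^sup>2 / h', h / h', 1 / h')\<close>.
\<close>

lemma null_curve_of_meromorphic: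
  fixes f :: "complex \<Rightarrow> complex" and z :: complex
  assumes f: "f nicely_meromorphic_on {z}" and pos: "spherical_deriv f z > 0"
  defines "A \<equiv> remove_sings (\<lambda>w. 1 / deriv f w)"
    and "B \<equiv> remove_sings (\<lambda>w. f w / deriv f w)"
    and "C \<equiv> remove_sings (\<lambda>w. f w ^ 2 / deriv f w)"
  shows "null_curve_at A B C z"
    and "sphere_val f z = sphere_point (A z) (B z)"
    and "norm (A z) + norm (C z) = 1 / spherical_deriv f z"
proof -
  have "null_curve_at A B C z \<and> sphere_val f z = sphere_point (A z) (B z) \<and>
      norm (A z) + norm (C z) = 1 / spherical_deriv f z"
  proof (cases "is_pole f z")
    case False
    then have an: "f analytic_on {z}"
      using f nicely_meromorphic_on_imp_analytic_at by blast
    have nz: "deriv f z \<noteq> 0"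
      using pos False by (auto simp: spherical_deriv_def)
    note null = null_curve_at_analytic[OF an nz]
    have *: "eventually (\<lambda>w. A w = 1 / deriv f w) (nhds z)"
        "eventually (\<lambda>w. B w = f w / deriv f w) (nhds z)"
        "eventually (\<lambda>w. C w = f w ^ 2 / deriv f w) (nhds z)"
      unfolding A_def B_def C_def
      using null by (auto simp: null_curve_at_def intro!: eventually_remove_sings_eq_nhds)
    show ?thesis
      using null_curve_at_cong[OF null *] *[THEN eventually_nhds_x_imp_x] False nz
      by (simp add: sphere_val_def sphere_point_def spherical_deriv_def norm_divide norm_power add_divide_distrib)
  next
    case True
    have mero: "f meromorphic_on {z}"
      using f by (simp add: nicely_meromorphic_on_def)
    define h where "h = remove_sings (\<lambda>w. inverse (f w))"
    note h = inverse_near_pole[OF mero True, folded h_def]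
    have "\<not> is_pole h z"
      using h(1) analytic_at_imp_no_pole by blast
    then have sd: "spherical_deriv f z = norm (deriv h z)"
      using spherical_deriv_pole[OF mero True] h(2) by (simp add: h_def[symmetric] spherical_deriv_def)
    then have nz: "deriv h z \<noteq> 0"
      using pos by auto
    note null = null_curve_at_uminus_swap[OF null_curve_at_analytic[OF h(1) nz]]
    have chart: "eventually (\<lambda>w. 1 / deriv f w = - (h w ^ 2 / deriv h w) \<and>
        f w / deriv f w = - (h w / deriv h w) \<and> f w ^ 2 / deriv f w = - (1 / deriv h w)) (at z)"
      using h(3) by eventually_elim (simp add: power2_eq_square field_simps)
    have *: "eventually (\<lambda>w. A w = - (h w ^ 2 / deriv h w)) (nhds z)"
        "eventually (\<lambda>w. B w = - (h w / deriv h w)) (nhds z)"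
        "eventually (\<lambda>w. C w = - (1 / deriv h w)) (nhds z)"
      unfolding A_def B_def C_def
      by (rule eventually_remove_sings_eq_analytic;
          use null chart in \<open>auto simp: null_curve_at_def elim!: eventually_mono\<close>)+
    show ?thesis
      using null_curve_at_cong[OF null *] *[THEN eventually_nhds_x_imp_x] True h(2) sd
      by (simp add: sphere_val_def sphere_point_def norm_divide)
  qed
  then show "null_curve_at A B C z" "sphere_val f z = sphere_point (A z) (B z)"
      "norm (A z) + norm (C z) = 1 / spherical_deriv f z"
    by auto
qed

section \<open>Compactness\<close>

lemma Montel_bounded:
  fixes F :: "nat \<Rightarrow> complex \<Rightarrow> complex"
  assumes "open S" "\<And>n. F n holomorphic_on S" "\<And>n z. z \<in> S \<Longrightarrow> norm (F n z) \<le> M"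
  obtains g r where "g holomorphic_on S" "strict_mono (r :: nat \<Rightarrow> nat)"
    "\<And>K. compact K \<Longrightarrow> K \<subseteq> S \<Longrightarrow> uniform_limit K (\<lambda>n. F (r n)) g sequentially"
proof -
  obtain g r where "g holomorphic_on S" "strict_mono (r :: nat \<Rightarrow> nat)"
      "\<And>K. compact K \<Longrightarrow> K \<subseteq> S \<Longrightarrow> uniform_limit K (F \<circ> r) g sequentially"
    by (rule Montel[OF assms(1), of "range F" F]) (use assms(2,3) in \<open>blast+\<close>)
  then show thesis
    by (intro that[of g r]) (simp_all add: o_def)
qed

lemma null_curve_at_limit:
  assumes S: "open S" "z \<in> S"
    and null: "\<And>n w. w \<in> S \<Longrightarrow> null_curve_at (An n) (Bn n) (Cn n) w"
    and hol: "A holomorphic_on S" "B holomorphic_on S" "C holomorphic_on S"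
    and lim: "\<And>K. compact K \<Longrightarrow> K \<subseteq> S \<Longrightarrow> uniform_limit K An A sequentially"
      "\<And>K. compact K \<Longrightarrow> K \<subseteq> S \<Longrightarrow> uniform_limit K Bn B sequentially"
      "\<And>K. compact K \<Longrightarrow> K \<subseteq> S \<Longrightarrow> uniform_limit K Cn C sequentially"
  shows "null_curve_at A B C z"
proof -
  obtain r where r: "r > 0" "cball z r \<subseteq> S"
    using S open_contains_cball by blast
  have *: "(\<lambda>n. Fn n z) \<longlonglongrightarrow> F z \<and> (\<lambda>n. deriv (Fn n) z) \<longlonglongrightarrow> deriv F z"
    if "\<And>n w. w \<in> S \<Longrightarrow> Fn n analytic_on {w}"
      "\<And>K. compact K \<Longrightarrow> K \<subseteq> S \<Longrightarrow> uniform_limit K Fn F sequentially"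
    for Fn :: "nat \<Rightarrow> complex \<Rightarrow> complex" and F
  proof -
    have ul: "uniform_limit (ball z r) Fn F sequentially"
      using that(2)[of "cball z r"] r by (auto intro: uniform_limit_on_subset)
    have "Fn n holomorphic_on ball z r" for n
      using that(1) r by (meson analytic_imp_holomorphic analytic_on_analytic_at ball_subset_cball subsetD)
    then have "(\<lambda>n. (deriv ^^ 1) (Fn n) z) \<longlonglongrightarrow> (deriv ^^ 1) F z"
      using r by (intro higher_deriv_complex_uniform_limit[OF ul]) auto
    moreover have "(\<lambda>n. Fn n z) \<longlonglongrightarrow> F z"
      using r by (intro tendsto_uniform_limitI[OF ul]) auto
    ultimately show ?thesis by simp
  qed
  have A: "An n analytic_on {w}" and B: "Bn n analytic_on {w}" and C: "Cn n analytic_on {w}"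
    if "w \<in> S" for n w
    using null[OF that] by (auto simp: null_curve_at_def)
  note limits = *[OF A lim(1)] *[OF B lim(2)] *[OF C lim(3)]
  have "(\<lambda>n. Bn n z ^ 2 - An n z * Cn n z) \<longlonglongrightarrow> B z ^ 2 - A z * C z"
    using limits by (intro tendsto_intros) auto
  moreover have "(\<lambda>n. Bn n z ^ 2 - An n z * Cn n z) = (\<lambda>n. 0)"
    using null[OF S(2)] by (auto simp: null_curve_at_def)
  ultimately have "B z ^ 2 = A z * C z"
    by (simp add: LIMSEQ_const_iff)
  moreover have "(\<lambda>n. deriv (Bn n) z ^ 2 - deriv (An n) z * deriv (Cn n) z)
      \<longlonglongrightarrow> deriv B z ^ 2 - deriv A z * deriv C z"
    using limits by (intro tendsto_intros) auto
  moreover have "(\<lambda>n. deriv (Bn n) z ^ 2 - deriv (An n) z * deriv (Cn n) z) = (\<lambda>n. 1)"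
    using null[OF S(2)] by (auto simp: null_curve_at_def)
  ultimately show ?thesis
    using hol S by (auto simp: null_curve_at_def LIMSEQ_const_iff analytic_at)
qed

lemma null_curve_nonzero:
  assumes "open S" "z \<in> S" "\<And>w. w \<in> S \<Longrightarrow> null_curve_at A B C w"
  shows "A z \<noteq> 0 \<or> C z \<noteq> 0"
proof (rule null_curve_at_no_common_zero[OF assms(3)[OF assms(2)]])
  show "eventually (\<lambda>w. B w ^ 2 = A w * C w) (nhds z)"
    using eventually_nhds_in_open[OF assms(1,2)]
    by eventually_elim (use assms(3) in \<open>auto simp: null_curve_at_def\<close>)
qed

text \<open>
  On a compact disk the limit curve satisfies \<open>|A| + |C| \<ge> m > 0\<close>, as \<open>A\<close> and \<open>C\<close> have no common zero,
  so \<open>chordal_dist_null_le\<close> bounds the distance by the uniform distance of the curves.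
\<close>

lemma null_curves_spherical_limit:
  assumes S: "open S"
    and nulln: "\<And>n w. w \<in> S \<Longrightarrow> null_curve_at (An n) (Bn n) (Cn n) w"
    and null: "\<And>w. w \<in> S \<Longrightarrow> null_curve_at A B C w"
    and lim: "\<And>K. compact K \<Longrightarrow> K \<subseteq> S \<Longrightarrow> uniform_limit K An A sequentially"
      "\<And>K. compact K \<Longrightarrow> K \<subseteq> S \<Longrightarrow> uniform_limit K Bn B sequentially"
      "\<And>K. compact K \<Longrightarrow> K \<subseteq> S \<Longrightarrow> uniform_limit K Cn C sequentially"
    and vals: "\<And>n z. z \<in> S \<Longrightarrow> F n z = sphere_point (An n z) (Bn n z)"
      "\<And>z. z \<in> S \<Longrightarrow> G z = sphere_point (A z) (B z)"
  shows "spherically_loc_unif_limit S F G"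
  unfolding spherically_loc_unif_limit_def
proof
  fix z0 assume z0: "z0 \<in> S"
  obtain \<rho> where \<rho>: "\<rho> > 0" "cball z0 \<rho> \<subseteq> S"
    using S z0 open_contains_cball by blast
  let ?K = "cball z0 \<rho>"
  have "continuous_on ?K A" "continuous_on ?K C"
    using null \<rho>(2)
    by (auto simp: null_curve_at_def intro!: continuous_at_imp_continuous_on analytic_at_imp_isCont)
  then have "continuous_on ?K (\<lambda>w. norm (A w) + norm (C w))"
    by (intro continuous_intros)
  then obtain w0 where w0: "w0 \<in> ?K" "\<And>w. w \<in> ?K \<Longrightarrow> norm (A w0) + norm (C w0) \<le> norm (A w) + norm (C w)"
    using continuous_attains_inf[of ?K "\<lambda>w. norm (A w) + norm (C w)"] \<rho>(1)
    by (auto simp: less_imp_le)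
  define m where "m = norm (A w0) + norm (C w0)"
  have m: "m > 0"
    using null_curve_nonzero[OF S subsetD[OF \<rho>(2) w0(1)] null]
    by (auto simp: m_def add_pos_nonneg add_nonneg_pos)
  have "\<forall>\<^sub>F n in sequentially. \<forall>z\<in>ball z0 \<rho>. spherical_dist (F n z) (G z) < e" if e: "e > 0" for e
  proof -
    obtain d where d: "d > 0" "\<And>p q. chordal_dist p q ^ 2 < d \<Longrightarrow> spherical_dist p q < e"
      using spherical_dist_less[OF e] by blast
    \<comment> \<open>The weights 1, 2, 1 in \<open>chordal_dist_null_le\<close> add up to 4.\<close>
    have d4: "d * m / 4 > 0" using d(1) m by simp
    note close = lim[OF compact_cball \<rho>(2), THEN uniform_limitD, OF d4]
    from close show ?thesis
    proof eventually_elim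
      case (elim n)
      show ?case
      proof
        fix z assume "z \<in> ball z0 \<rho>"
        then have K: "z \<in> ?K" and z: "z \<in> S" using \<rho>(2) by auto
        have "chordal_dist (F n z) (G z) ^ 2 \<le>
            (norm (An n z - A z) + 2 * norm (Bn n z - B z) + norm (Cn n z - C z)) / (norm (A z) + norm (C z))"
          unfolding vals[OF z]
          using nulln[OF z] null[OF z] null_curve_nonzero[OF S z null] null_curve_nonzero[OF S z nulln]
          by (intro chordal_dist_null_le) (auto simp: null_curve_at_def)
        also have "\<dots> \<le> (norm (An n z - A z) + 2 * norm (Bn n z - B z) + norm (Cn n z - C z)) / m"
          using w0(2)[OF K] m by (intro divide_left_mono mult_pos_pos) (auto simp: m_def)
        also have "\<dots> < d"
        proof -
          have "norm (An n z - A z) < d * m / 4" "norm (Bn n z - B z) < d * m / 4"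
              "norm (Cn n z - C z) < d * m / 4"
            using elim K by (auto simp: dist_norm)
          then have "norm (An n z - A z) + 2 * norm (Bn n z - B z) + norm (Cn n z - C z) < d * m"
            by linarith
          then show ?thesis using m by (simp add: pos_divide_less_eq)
        qed
        finally show "spherical_dist (F n z) (G z) < e" by (rule d(2))
      qed
    qed
  qed
  then show "\<exists>U. open U \<and> z0 \<in> U \<and> U \<subseteq> S \<and>
      (\<forall>e>0. \<forall>\<^sub>F n in sequentially. \<forall>z\<in>U. spherical_dist (F n z) (G z) < e)"
    using \<rho> by (intro exI[of _ "ball z0 \<rho>"]) auto
qed

text \<open>
  The null curves of the family are bounded by \<open>1 / \<epsilon>\<close>. Their three components are passed through
  Montel's theorem one after the other, each time refining the subsequence; the limit function is
  the quotient \<open>B / A\<close> of the limit curve.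
\<close>

lemma normal_family_spherical_deriv_ge:
  fixes \<epsilon> :: real and S :: "complex set"
  assumes \<epsilon>: "\<epsilon> > 0" and S: "open S"
  shows "normal_family S {f. f nicely_meromorphic_on S \<and> (\<forall>z\<in>S. spherical_deriv f z \<ge> \<epsilon>)}"
  unfolding normal_family_def
proof (intro allI impI)
  fix f :: "nat \<Rightarrow> complex \<Rightarrow> complex"
  assume "\<forall>n. f n \<in> {f. f nicely_meromorphic_on S \<and> (\<forall>z\<in>S. spherical_deriv f z \<ge> \<epsilon>)}"
  then have f: "f n nicely_meromorphic_on {z}" "spherical_deriv (f n) z \<ge> \<epsilon>"
      "spherical_deriv (f n) z > 0" if "z \<in> S" for n z
    using that \<epsilon> by (auto intro: nicely_meromorphic_on_subset less_le_trans)
  define An where "An n = remove_sings (\<lambda>w. 1 / deriv (f n) w)" for n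
  define Bn where "Bn n = remove_sings (\<lambda>w. f n w / deriv (f n) w)" for n
  define Cn where "Cn n = remove_sings (\<lambda>w. f n w ^ 2 / deriv (f n) w)" for n
  note lift = null_curve_of_meromorphic[OF f(1,3), folded An_def Bn_def Cn_def]
  have hol: "An n holomorphic_on S" "Bn n holomorphic_on S" "Cn n holomorphic_on S" for n
    using lift(1) unfolding null_curve_at_def
    by (meson analytic_imp_holomorphic analytic_on_analytic_at)+
  have AC: "norm (An n z) + norm (Cn n z) \<le> 1 / \<epsilon>" if "z \<in> S" for n z
    unfolding lift(3)[OF that that] using f(2,3)[OF that] \<epsilon> by (intro divide_left_mono mult_pos_pos) auto
  have bound: "norm (An n z) \<le> 1 / \<epsilon>" "norm (Bn n z) \<le> 1 / \<epsilon>" "norm (Cn n z) \<le> 1 / \<epsilon>"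
    if "z \<in> S" for n z
  proof -
    have "norm (Bn n z) \<le> norm (An n z) + norm (Cn n z)"
      using lift(1)[OF that that] by (intro norm_null_le) (simp add: null_curve_at_def)
    then show "norm (An n z) \<le> 1 / \<epsilon>" "norm (Bn n z) \<le> 1 / \<epsilon>" "norm (Cn n z) \<le> 1 / \<epsilon>"
      using AC[OF that, of n] norm_ge_zero[of "An n z"] norm_ge_zero[of "Cn n z"] by linarith+
  qed
  obtain A r1 where A: "A holomorphic_on S" "strict_mono r1"
      "\<And>K. compact K \<Longrightarrow> K \<subseteq> S \<Longrightarrow> uniform_limit K (\<lambda>n. An (r1 n)) A sequentially"
    using Montel_bounded[OF S, of An] hol bound by metis
  obtain B r2 where B: "B holomorphic_on S" "strict_mono r2"
      "\<And>K. compact K \<Longrightarrow> K \<subseteq> S \<Longrightarrow> uniform_limit K (\<lambda>n. Bn (r1 (r2 n))) B sequentially"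
    using Montel_bounded[OF S, of "\<lambda>n. Bn (r1 n)"] hol bound by metis
  obtain C r3 where C: "C holomorphic_on S" "strict_mono r3"
      "\<And>K. compact K \<Longrightarrow> K \<subseteq> S \<Longrightarrow> uniform_limit K (\<lambda>n. Cn (r1 (r2 (r3 n)))) C sequentially"
    using Montel_bounded[OF S, of "\<lambda>n. Cn (r1 (r2 n))"] hol bound by metis
  define r where "r n = r1 (r2 (r3 n))" for n
  have r: "strict_mono r"
    using A(2) B(2) C(2) by (simp add: r_def strict_mono_def)
  have lim: "uniform_limit K (\<lambda>n. An (r n)) A sequentially"
      "uniform_limit K (\<lambda>n. Bn (r n)) B sequentially"
      "uniform_limit K (\<lambda>n. Cn (r n)) C sequentially" if "compact K" "K \<subseteq> S" for K
  proof -
    have "filterlim r3 at_top sequentially" "filterlim (\<lambda>n. r2 (r3 n)) at_top sequentially"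
      using B(2) C(2) by (auto intro!: filterlim_subseq simp: strict_mono_def)
    then show "uniform_limit K (\<lambda>n. An (r n)) A sequentially"
        "uniform_limit K (\<lambda>n. Bn (r n)) B sequentially"
        "uniform_limit K (\<lambda>n. Cn (r n)) C sequentially"
      using A(3)[OF that] B(3)[OF that] C(3)[OF that]
      unfolding r_def by (auto intro: filterlim_compose)
  qed
  have null: "null_curve_at A B C z" if "z \<in> S" for z
    by (rule null_curve_at_limit[OF S that _ A(1) B(1) C(1) lim]) (use lift(1) in auto)
  define g where "g = remove_sings (\<lambda>w. B w / A w)"
  have "spherically_loc_unif_limit S (\<lambda>n. sphere_val (f (r n))) (sphere_val g)"
    by (rule null_curves_spherical_limit[OF S _ null lim])
      (use lift(1,2) null_curve_sphere_val(2)[OF S null] in \<open>auto simp: g_def\<close>)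
  moreover have "g nicely_meromorphic_on S"
    unfolding g_def using null_curve_sphere_val(1)[OF S null] .
  ultimately show "\<exists>r. strict_mono r \<and>
      ((\<exists>g. g nicely_meromorphic_on S \<and>
            spherically_loc_unif_limit S (\<lambda>n. sphere_val (f (r n))) (sphere_val g)) \<or>
       spherically_loc_unif_limit S (\<lambda>n. sphere_val (f (r n))) (\<lambda>_. Infty))"
    using r by blast
qed

theorem theorem1:
  fixes \<epsilon> :: real
  assumes "\<epsilon> > 0"
  shows "normal_family (ball 0 1)
           {f. f nicely_meromorphic_on ball 0 1 \<and> (\<forall>z\<in>ball 0 1. spherical_deriv f z \<ge> \<epsilon>)}"
  by (rule normal_family_spherical_deriv_ge[OF assms open_ball])

end
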